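(* Let $g:\mathbb{R}^4\to\mathbb{R}^4$ be defined by $$g(x_1,x_2,x_3,x_4)=\left(\frac{x_1^2-x_2^2}{\sqrt{x_1^2+x_2^2}},\frac{2x_1x_2}{\sqrt{x_1^2+x_2^2}},\frac{x_3^2-x_4^2}{\sqrt{x_3^2+x_4^2}},\frac{2x_3x_4}{\sqrt{x_3^2+x_4^2}}\right),$$ where for $i=1,3$, if $x_i=x_{i+1}=0$, the pair $\left(\frac{x_i^2-x_{i+1}^2}{\sqrt{x_i^2+x_{i+1}^2}},\frac{2x_ix_{i+1}}{\sqrt{x_i^2+x_{i+1}^2}}\right)$ is defined to be $(0,0)$. Let $z=(z_1,z_2,z_3,z_4)\in\mathbb{R}^4\setminus\{\theta\}$ with $(z_1^2+z_2^2)(z_3^2+z_4^2)\ne 0$. Then $g$ is Fréchet differentiable and Mordukhovich differentiable at $z$, with $$\nabla g(z)=\begin{pmatrix}\frac{(z_1^2+3z_2^2)z_1}{(z_1^2+z_2^2)\sqrt{z_1^2+z_2^2}}&\frac{2z_2^2z_2}{(z_1^2+z_2^2)\sqrt{z_1^2+z_2^2}}&0&0\\ \frac{-(3z_1^2+z_2^2)z_2}{(z_1^2+z_2^2)\sqrt{z_1^2+z_2^2}}&\frac{2z_1^2z_1}{(z_1^2+z_2^2)\sqrt{z_1^2+z_2^2}}&0&0\\0&0&\frac{(z_3^2+3z_4^2)z_3}{(z_3^2+z_4^2)\sqrt{z_3^2+z_4^2}}&\frac{2z_4^2z_4}{(z_3^2+z_4^2)\sqrt{z_3^2+z_4^2}}\\0&0&\frac{-(3z_3^2+z_4^2)z_4}{(z_3^2+z_4^2)\sqrt{z_3^2+z_4^2}}&\frac{2z_3^2z_3}{(z_3^2+z_4^2)\sqrt{z_3^2+z_4^2}}\end{pmatrix}$$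 and $$\widehat{D}^*g(z)=\begin{pmatrix}\frac{(z_1^2+3z_2^2)z_1}{(z_1^2+z_2^2)\sqrt{z_1^2+z_2^2}}&\frac{-(3z_1^2+z_2^2)z_2}{(z_1^2+z_2^2)\sqrt{z_1^2+z_2^2}}&0&0\\ \frac{2z_2^2z_2}{(z_1^2+z_2^2)\sqrt{z_1^2+z_2^2}}&\frac{2z_1^2z_1}{(z_1^2+z_2^2)\sqrt{z_1^2+z_2^2}}&0&0\\0&0&\frac{(z_3^2+3z_4^2)z_3}{(z_3^2+z_4^2)\sqrt{z_3^2+z_4^2}}&\frac{-(3z_3^2+z_4^2)z_4}{(z_3^2+z_4^2)\sqrt{z_3^2+z_4^2}}\\0&0&\frac{2z_4^2z_4}{(z_3^2+z_4^2)\sqrt{z_3^2+z_4^2}}&\frac{2z_3^2z_3}{(z_3^2+z_4^2)\sqrt{z_3^2+z_4^2}}\end{pmatrix}.$$ More precisely, for $x=(x_1,x_2,x_3,x_4),\,y=(y_1,y_2,y_3,y_4)\in\mathbb{R}^4$, if $x=\widehat{D}^*g(z)(y)$, then $$x_1=y_1\frac{(z_1^2+3z_2^2)z_1}{(z_1^2+z_2^2)\sqrt{z_1^2+z_2^2}}+y_2\frac{2z_2^2z_2}{(z_1^2+z_2^2)\sqrt{z_1^2+z_2^2}},\quad x_2=y_1\frac{(-3z_1^2-z_2^2)z_2}{(z_1^2+z_2^2)\sqrt{z_1^2+z_2^2}}+y_2\frac{2z_1^2z_1}{(z_1^2+z_2^2)\sqrt{z_1^2+z_2^2}},$$ $$x_3=y_3\frac{(z_3^2+3z_4^2)z_3}{(z_3^2+z_4^2)\sqrt{z_3^2+z_4^2}}+y_4\frac{2z_4^2z_4}{(z_3^2+z_4^2)\sqrt{z_3^2+z_4^2}},\quad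 x_4=y_3\frac{-(3z_3^2+z_4^2)z_4}{(z_3^2+z_4^2)\sqrt{z_3^2+z_4^2}}+y_4\frac{2z_3^2z_3}{(z_3^2+z_4^2)\sqrt{z_3^2+z_4^2}}.$$
   Context: $\theta$ denotes the origin; $\mathbb{R}^4$ has the Euclidean norm and inner product. Vectors are row vectors, and a matrix $A$ represents the linear map $u\mapsto uA$. $g$ is Fréchet differentiable at $z$ with derivative $\nabla g(z)$ (linear) if $\lim_{x\to z}\frac{g(x)-g(z)-\nabla g(z)(x-z)}{\|x-z\|}=\theta$. Mordukhovich derivative: for $y\in\mathbb{R}^4$, $\widehat{D}^*g(z)(y)=\Big\{x\in\mathbb{R}^4:\limsup_{u\to z}\frac{\langle x,u-z\rangle-\langle y,g(u)-g(z)\rangle}{\|u-z\|+\|g(u)-g(z)\|}\le 0\Big\}$ ($g$ is continuous). $g$ is Mordukhovich differentiable at $z$ if this set is nonempty for every $y$. That $\widehat{D}^*g(z)$ equals a matrix $B$ means $\widehat{D}^*g(z)(y)=\{yB\}$ for every $y$; a singleton value is identified with its element. *)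

theory Defs
  imports "HOL-Analysis.Analysis"
begin

text \<open>
  Vectors are row vectors, so a matrix \<open>A\<close> acts by \<open>u \<mapsto> u v* A\<close>. In
  \<open>vector [r\<^sub>1, \<dots>, r\<^sub>4] :: real^4^4\<close> the entries of the list are the rows. In the index type
  \<open>4\<close> the numerals \<open>4\<close> and \<open>0\<close> coincide; the lemma below shows that \<open>vector\<close> nevertheless
  enumerates the coordinates in the order 1, 2, 3, 4.
\<close>

lemma vector_4 [simp]:
  "(vector [a, b, c, d] :: 'a::zero^4) $ 1 = a"
  "(vector [a, b, c, d] :: 'a::zero^4) $ 2 = b"
  "(vector [a, b, c, d] :: 'a::zero^4) $ 3 = c"
  "(vector [a, b, c, d] :: 'a::zero^4) $ 4 = d"
  unfolding vector_def by auto

text \<open>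
  The Mordukhovich derivative (coderivative) of a single-valued map \<open>g\<close>, in the form valid for
  continuous \<open>g\<close>, where \<open>u\<close> tends to \<open>z\<close> through points other than \<open>z\<close>. The upper limit is
  taken in the extended reals, so that it always exists.
\<close>

definition mordukhovich_derivative ::
  "('a::real_inner \<Rightarrow> 'b::real_inner) \<Rightarrow> 'a \<Rightarrow> 'b \<Rightarrow> 'a set" where
  "mordukhovich_derivative g z y =
    {x. Limsup (at z)
          (\<lambda>u. ereal ((inner x (u - z) - inner y (g u - g z)) / (norm (u - z) + norm (g u - g z)))) \<le> 0}"

definition mordukhovich_differentiable ::
  "('a::real_inner \<Rightarrow> 'b::real_inner) \<Rightarrow> 'a \<Rightarrow> bool" where
  "mordukhovich_differentiable g z \<longleftrightarrow> (\<forall>y. mordukhovich_derivative g z y \<noteq> {})"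

definition g_map :: "real^4 \<Rightarrow> real^4" where
  "g_map x = vector
    [if x$1 = 0 \<and> x$2 = 0 then 0 else ((x$1)^2 - (x$2)^2) / sqrt ((x$1)^2 + (x$2)^2),
     if x$1 = 0 \<and> x$2 = 0 then 0 else (2 * x$1 * x$2) / sqrt ((x$1)^2 + (x$2)^2),
     if x$3 = 0 \<and> x$4 = 0 then 0 else ((x$3)^2 - (x$4)^2) / sqrt ((x$3)^2 + (x$4)^2),
     if x$3 = 0 \<and> x$4 = 0 then 0 else (2 * x$3 * x$4) / sqrt ((x$3)^2 + (x$4)^2)]"

end

theory Submission
  imports Defs
begin

text \<open>
  At a point of differentiability the coderivative consists of the vectors \<open>x\<close> representing the
  functional \<open>h \<mapsto> \<langle>y, g'(z) h\<rangle>\<close>: the difference between \<open>\<langle>x, h\<rangle>\<close> and \<open>\<langle>y, g'(z) h\<rangle>\<close> is the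
  one-sided limit of the defining quotient along the ray \<open>z + t h\<close>, up to the positive factor
  \<open>\<parallel>h\<parallel> + \<parallel>g'(z) h\<parallel>\<close>, and replacing \<open>h\<close> by \<open>-h\<close> changes its sign. Hence the coderivative is given
  by the transpose of the Jacobian matrix.
\<close>

section \<open>The coderivative of a Frechet differentiable map\<close>

lemma mem_mordukhovich_derivative_iff:
  "x \<in> mordukhovich_derivative g z y \<longleftrightarrow>
    (\<forall>e>0. \<forall>\<^sub>F u in at z.
      (inner x (u - z) - inner y (g u - g z)) / (norm (u - z) + norm (g u - g z)) < e)"
  (is "_ \<longleftrightarrow> (\<forall>e>0. \<forall>\<^sub>F u in at z. ?Q u < e)")
proof -
  have "(\<forall>C>0. \<forall>\<^sub>F u in at z. ereal (?Q u) < C) \<longleftrightarrow> (\<forall>e>0. \<forall>\<^sub>F u in at z. ?Q u < e)"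
  proof (intro iffI allI impI)
    fix e :: real
    assume "\<forall>C>0. \<forall>\<^sub>F u in at z. ereal (?Q u) < C" "e > 0"
    then have "\<forall>\<^sub>F u in at z. ereal (?Q u) < ereal e"
      by (simp del: less_ereal.simps add: zero_less_real_of_ereal)
    then show "\<forall>\<^sub>F u in at z. ?Q u < e" by simp
  next
    fix C :: ereal
    assume *: "\<forall>e>0. \<forall>\<^sub>F u in at z. ?Q u < e" and "C > 0"
    \<comment> \<open>The threshold \<open>C\<close> may be infinite, so a real number strictly
      between 0 and \<open>C\<close> takes its place.\<close>
    then obtain e where "0 < ereal e" "ereal e < C"
      using ereal_dense2 by blast
    with * have "\<forall>\<^sub>F u in at z. ?Q u < e" by simp
    then show "\<forall>\<^sub>F u in at z. ereal (?Q u) < C"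
      by eventually_elim (use \<open>ereal e < C\<close> in \<open>metis less_ereal.simps(1) less_trans\<close>)
  qed
  then show ?thesis
    by (simp add: mordukhovich_derivative_def Limsup_le_iff)
qed

text \<open>This is the chain rule along the ray \<open>t \<mapsto> z + t *\<^sub>R h\<close>: by
  linearity the scalar \<open>t\<close> leaves \<open>f' (t *\<^sub>R h)\<close> and cancels. The
  right-sided limit is enough, since a coderivative inequality is tested on one ray at a
  time.\<close>

lemma has_derivative_difference_quotient:
  fixes f :: "'a::real_normed_vector \<Rightarrow> 'b::real_normed_vector"
  assumes "(f has_derivative f') (at z)"
  shows "((\<lambda>t. (f (z + t *\<^sub>R h) - f z) /\<^sub>R t) \<longlongrightarrow> f' h) (at_right 0)"
proof -
  have "((\<lambda>t. f (z + t *\<^sub>R h)) has_derivative (\<lambda>t. f' (t *\<^sub>R h))) (at_right 0)"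
    by (rule has_derivative_compose[where g = f and f = "\<lambda>t. z + t *\<^sub>R h"])
      (use assms in \<open>auto intro!: derivative_eq_intros\<close>)
  then have "((\<lambda>t. norm (f (z + t *\<^sub>R h) - f z - f' (t *\<^sub>R h)) / \<bar>t\<bar>) \<longlongrightarrow> 0) (at_right 0)"
    by (simp add: has_derivative_iff_norm)
  moreover have "\<forall>\<^sub>F t in at_right (0::real).
    norm (f (z + t *\<^sub>R h) - f z - f' (t *\<^sub>R h)) / \<bar>t\<bar> = norm ((f (z + t *\<^sub>R h) - f z) /\<^sub>R t - f' h)"
    using eventually_at_right_less[of 0]
  proof eventually_elim
    case (elim t)
    have "(f (z + t *\<^sub>R h) - f z) /\<^sub>R t - f' h = (f (z + t *\<^sub>R h) - f z - f' (t *\<^sub>R h)) /\<^sub>R t"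
      using elim linear_cmul[OF has_derivative_linear[OF assms]] by (simp add: scaleR_diff_right)
    then show ?case by (simp add: divide_inverse mult.commute)
  qed
  ultimately have "((\<lambda>t. norm ((f (z + t *\<^sub>R h) - f z) /\<^sub>R t - f' h)) \<longlongrightarrow> 0) (at_right 0)"
    by (rule Lim_transform_eventually)
  then show ?thesis
    using Lim_null tendsto_norm_zero_iff by blast
qed

lemma mordukhovich_derivative_le:
  assumes deriv: "(g has_derivative g') (at z)"
    and x: "x \<in> mordukhovich_derivative g z y"
  shows "inner x h \<le> inner y (g' h)"
proof (cases "h = 0")
  case True
  then show ?thesis
    using linear_0[OF has_derivative_linear[OF deriv]] by simp
next
  case False
  define Q where
    "Q u = (inner x (u - z) - inner y (g u - g z)) / (norm (u - z) + norm (g u - g z))" for u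
  define q where "q t = (g (z + t *\<^sub>R h) - g z) /\<^sub>R t" for t :: real
  \<comment> \<open>Numerator and denominator of \<open>Q\<close> on the ray are both divided by
    \<open>t\<close>, so that each of them converges. The limit of the denominator is nonzero
    because \<open>h \<noteq> 0\<close>.\<close>
  have "((\<lambda>t. (inner x h - inner y (q t)) / (norm h + norm (q t))) \<longlongrightarrow>
      (inner x h - inner y (g' h)) / (norm h + norm (g' h))) (at_right 0)"
    using has_derivative_difference_quotient[OF deriv, of h] False
    unfolding q_def by (intro tendsto_intros) (auto simp: add_nonneg_eq_0_iff)
  moreover have "\<forall>\<^sub>F t in at_right (0::real).
      (inner x h - inner y (q t)) / (norm h + norm (q t)) = Q (z + t *\<^sub>R h)"
    using eventually_at_right_less[of 0]
  proof eventually_elim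
    case (elim t)
    then have g: "g (z + t *\<^sub>R h) - g z = t *\<^sub>R q t" by (simp add: q_def)
    have "Q (z + t *\<^sub>R h) = (t * (inner x h - inner y (q t))) / (t * (norm h + norm (q t)))"
      using elim unfolding Q_def g by (simp add: algebra_simps)
    then show ?case using elim by simp
  qed
  ultimately have lim: "((\<lambda>t. Q (z + t *\<^sub>R h)) \<longlongrightarrow>
      (inner x h - inner y (g' h)) / (norm h + norm (g' h))) (at_right 0)"
    by (rule Lim_transform_eventually)
  \<comment> \<open>The filter \<open>at z\<close> leaves out \<open>z\<close> itself, so the ray
    has to avoid its starting point; it does since both \<open>t\<close> and \<open>h\<close> are
    nonzero.\<close>
  have ray: "filterlim (\<lambda>t. z + t *\<^sub>R h) (at z) (at_right 0)"
  proof (rule filterlim_atI)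
    show "((\<lambda>t. z + t *\<^sub>R h) \<longlongrightarrow> z) (at_right 0)"
      by (auto intro!: tendsto_eq_intros)
    show "\<forall>\<^sub>F t in at_right 0. z + t *\<^sub>R h \<noteq> z"
      using eventually_at_right_less[of 0] by eventually_elim (use False in auto)
  qed
  have "(inner x h - inner y (g' h)) / (norm h + norm (g' h)) \<le> e" if "e > 0" for e
  proof (rule tendsto_upperbound[OF lim])
    have "\<forall>\<^sub>F u in at z. Q u < e"
      using x that by (simp add: mem_mordukhovich_derivative_iff Q_def)
    from eventually_compose_filterlim[OF this ray]
    show "\<forall>\<^sub>F t in at_right 0. Q (z + t *\<^sub>R h) \<le> e"
      by (rule eventually_mono) simp
  qed auto
  then have "(inner x h - inner y (g' h)) / (norm h + norm (g' h)) \<le> 0"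
    by (rule field_le_epsilon) simp
  moreover have "norm h + norm (g' h) > 0"
    using False by (simp add: add_pos_nonneg)
  ultimately show ?thesis
    by (simp add: divide_le_0_iff)
qed

text \<open>By \<open>eq\<close> the numerator is \<open>inner y\<close> of the negated Taylor
  remainder, which Cauchy-Schwarz bounds by \<open>norm y\<close> times the norm of the remainder.
  Dropping \<open>norm (g u - g z)\<close> from the denominator only enlarges this bound, and the
  remainder is small compared with \<open>norm (u - z)\<close>.\<close>

lemma mordukhovich_derivativeI:
  assumes deriv: "(g has_derivative g') (at z)"
    and eq: "\<And>h. inner x h = inner y (g' h)"
  shows "x \<in> mordukhovich_derivative g z y"
  unfolding mem_mordukhovich_derivative_iff
proof (intro allI impI)
  fix e :: real
  assume "e > 0"
  have "((\<lambda>u. norm y * (norm (g u - g z - g' (u - z)) / norm (u - z))) \<longlongrightarrow> norm y * 0) (at z)"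
    using deriv by (intro tendsto_mult tendsto_const) (simp add: has_derivative_iff_norm)
  then have "\<forall>\<^sub>F u in at z. norm y * (norm (g u - g z - g' (u - z)) / norm (u - z)) < e"
    using \<open>e > 0\<close> by (simp add: order_tendstoD(2))
  moreover have "\<forall>\<^sub>F u in at z. u \<noteq> z"
    by (simp add: eventually_at_filter)
  ultimately show "\<forall>\<^sub>F u in at z.
      (inner x (u - z) - inner y (g u - g z)) / (norm (u - z) + norm (g u - g z)) < e"
  proof eventually_elim
    case (elim u)
    have "inner x (u - z) - inner y (g u - g z) = inner y (- (g u - g z - g' (u - z)))"
      unfolding eq[of "u - z"] by (simp add: inner_diff_right)
    also have "\<dots> \<le> norm y * norm (g u - g z - g' (u - z))"
      by (metis norm_cauchy_schwarz norm_minus_cancel)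
    finally have "(inner x (u - z) - inner y (g u - g z)) / (norm (u - z) + norm (g u - g z))
        \<le> norm y * norm (g u - g z - g' (u - z)) / (norm (u - z) + norm (g u - g z))"
      by (intro divide_right_mono) auto
    also have "\<dots> \<le> norm y * norm (g u - g z - g' (u - z)) / norm (u - z)"
      using elim by (intro divide_left_mono) (auto intro!: mult_pos_pos add_pos_nonneg)
    finally show ?case using elim by simp
  qed
qed

theorem mordukhovich_derivative_has_derivative:
  assumes deriv: "(g has_derivative g') (at z)"
  shows "mordukhovich_derivative g z y = {x. \<forall>h. inner x h = inner y (g' h)}"
proof (intro equalityI subsetI CollectI allI)
  fix x h
  assume x: "x \<in> mordukhovich_derivative g z y"
  have "inner x (- h) \<le> inner y (g' (- h))"
    by (rule mordukhovich_derivative_le[OF deriv x])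
  then have "inner y (g' h) \<le> inner x h"
    using linear_neg[OF has_derivative_linear[OF deriv]] by simp
  with mordukhovich_derivative_le[OF deriv x] show "inner x h = inner y (g' h)"
    by (simp add: order_antisym)
qed (simp add: mordukhovich_derivativeI[OF deriv])

text \<open>The adjoint of \<open>u \<mapsto> u v* A\<close> is multiplication by the transpose, and
  a vector is determined by its inner products with all \<open>h\<close>. Hence the coderivative has
  exactly one element.\<close>

corollary mordukhovich_derivative_matrix:
  fixes A :: "real^'m^'n"
  assumes "(g has_derivative (\<lambda>u. u v* A)) (at z)"
  shows "mordukhovich_derivative g z y = {y v* transpose A}"
proof -
  have "inner y (h v* A) = inner (y v* transpose A) h" for h
    by (simp only: dot_lmul_matrix transpose_matrix_vector)
  then show ?thesis
    unfolding mordukhovich_derivative_has_derivative[OF assms]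
    by (auto simp: vector_eq_rdot)
qed

section \<open>Derivatives of the component functions\<close>

lemma has_derivative_vec_nthI:
  fixes f :: "'a::real_normed_vector \<Rightarrow> real^'n"
  assumes "\<And>i. ((\<lambda>x. f x $ i) has_derivative (\<lambda>h. f' h $ i)) (at z within S)"
  shows "(f has_derivative f') (at z within S)"
  by (subst has_derivative_componentwise_within)
    (use assms in \<open>auto simp: Basis_vec_def inner_axis\<close>)

lemmas has_derivative_vec_nth [derivative_intros] =
  bounded_linear.has_derivative[OF bounded_linear_vec_nth]

lemma has_derivative_sqrt_sum_squares:
  fixes z :: "real^'n"
  assumes "(z$i)\<^sup>2 + (z$j)\<^sup>2 > 0"
  shows "((\<lambda>x. sqrt ((x$i)\<^sup>2 + (x$j)\<^sup>2)) has_derivative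
    (\<lambda>h. (z$i * h$i + z$j * h$j) / sqrt ((z$i)\<^sup>2 + (z$j)\<^sup>2))) (at z)"
proof -
  have sq: "((\<lambda>x. (x$i)\<^sup>2 + (x$j)\<^sup>2) has_derivative (\<lambda>h. 2 * (z$i * h$i + z$j * h$j))) (at z)"
    by (auto intro!: derivative_eq_intros simp: algebra_simps)
  \<comment> \<open>The chain rule for \<open>sqrt\<close> produces the factor
    \<open>inverse s / 2\<close>. As a rewrite rule the identity is needed for every
    \<open>s\<close>; at \<open>s = 0\<close> both sides are 0.\<close>
  have "2 * c * (inverse s / 2) = c / s" for c s :: real
    by (cases "s = 0") (simp_all add: field_simps)
  from has_derivative_real_sqrt[OF _ sq, unfolded this] assms show ?thesis
    by blast
qed

lemma has_derivative_square_diff_over_norm: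
  fixes z :: "real^'n"
  assumes "(z$i)\<^sup>2 + (z$j)\<^sup>2 \<noteq> 0"
  shows "((\<lambda>x. ((x$i)\<^sup>2 - (x$j)\<^sup>2) / sqrt ((x$i)\<^sup>2 + (x$j)\<^sup>2)) has_derivative
    (\<lambda>h. h$i * ((((z$i)\<^sup>2 + 3 * (z$j)\<^sup>2) * z$i) / (((z$i)\<^sup>2 + (z$j)\<^sup>2) * sqrt ((z$i)\<^sup>2 + (z$j)\<^sup>2)))
       + h$j * ((- (3 * (z$i)\<^sup>2 + (z$j)\<^sup>2) * z$j) / (((z$i)\<^sup>2 + (z$j)\<^sup>2) * sqrt ((z$i)\<^sup>2 + (z$j)\<^sup>2)))))
    (at z)"
proof -
  define a b r where "a = z$i" and "b = z$j" and "r = sqrt (a\<^sup>2 + b\<^sup>2)"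
  have pos: "a\<^sup>2 + b\<^sup>2 > 0"
    using assms by (simp add: a_def b_def sum_power2_gt_zero_iff)
  then have r: "r > 0" "r\<^sup>2 = a\<^sup>2 + b\<^sup>2"
    by (simp_all add: r_def)
  have num: "((\<lambda>x. (x$i)\<^sup>2 - (x$j)\<^sup>2) has_derivative (\<lambda>h. 2 * a * h$i - 2 * b * h$j)) (at z)"
    by (auto intro!: derivative_eq_intros simp: a_def b_def)
  have den: "((\<lambda>x. sqrt ((x$i)\<^sup>2 + (x$j)\<^sup>2)) has_derivative (\<lambda>h. (a * h$i + b * h$j) / r)) (at z)"
    using has_derivative_sqrt_sum_squares pos by (simp add: a_def b_def r_def)
  have "((2 * a * h$i - 2 * b * h$j) * r - (a\<^sup>2 - b\<^sup>2) * ((a * h$i + b * h$j) / r)) / (r * r) =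
      h$i * (((a\<^sup>2 + 3 * b\<^sup>2) * a) / ((a\<^sup>2 + b\<^sup>2) * r))
        + h$j * ((- (3 * a\<^sup>2 + b\<^sup>2) * b) / ((a\<^sup>2 + b\<^sup>2) * r))" (is "?L = ?R") for h :: "real^'n"
  proof -
    \<comment> \<open>Expanding the fraction by \<open>r\<close> clears the inner division. With
      \<open>r\<^sup>2 = a\<^sup>2 + b\<^sup>2\<close> the coefficient of \<open>h$i\<close> becomes
      2a(a^2 + b^2) - (a^2 - b^2)a = (a^2 + 3b^2)a, and that of \<open>h$j\<close> becomes -2b(a^2 +
      b^2) - (a^2 - b^2)b = -(3a^2 + b^2)b.\<close>
    have "?L = ((2 * a * h$i - 2 * b * h$j) * r\<^sup>2 - (a\<^sup>2 - b\<^sup>2) * (a * h$i + b * h$j)) / (r\<^sup>2 * r)"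
      using r(1) by (simp add: field_simps power2_eq_square)
    also have "\<dots> = ?R"
      unfolding r(2) by (simp add: add_divide_distrib[symmetric]) (simp add: algebra_simps power2_eq_square)
    finally show ?thesis .
  qed
  from has_derivative_divide'[OF num den, folded a_def b_def, folded r_def, unfolded this] assms
  show ?thesis
    by (simp add: a_def b_def r_def)
qed

lemma has_derivative_two_mult_over_norm:
  fixes z :: "real^'n"
  assumes "(z$i)\<^sup>2 + (z$j)\<^sup>2 \<noteq> 0"
  shows "((\<lambda>x. (2 * x$i * x$j) / sqrt ((x$i)\<^sup>2 + (x$j)\<^sup>2)) has_derivative
    (\<lambda>h. h$i * ((2 * (z$j)\<^sup>2 * z$j) / (((z$i)\<^sup>2 + (z$j)\<^sup>2) * sqrt ((z$i)\<^sup>2 + (z$j)\<^sup>2)))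
       + h$j * ((2 * (z$i)\<^sup>2 * z$i) / (((z$i)\<^sup>2 + (z$j)\<^sup>2) * sqrt ((z$i)\<^sup>2 + (z$j)\<^sup>2)))))
    (at z)"
proof -
  define a b r where "a = z$i" and "b = z$j" and "r = sqrt (a\<^sup>2 + b\<^sup>2)"
  have pos: "a\<^sup>2 + b\<^sup>2 > 0"
    using assms by (simp add: a_def b_def sum_power2_gt_zero_iff)
  then have r: "r > 0" "r\<^sup>2 = a\<^sup>2 + b\<^sup>2"
    by (simp_all add: r_def)
  have num: "((\<lambda>x. 2 * x$i * x$j) has_derivative (\<lambda>h. 2 * b * h$i + 2 * a * h$j)) (at z)"
    by (auto intro!: derivative_eq_intros simp: a_def b_def)
  have den: "((\<lambda>x. sqrt ((x$i)\<^sup>2 + (x$j)\<^sup>2)) has_derivative (\<lambda>h. (a * h$i + b * h$j) / r)) (at z)"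
    using has_derivative_sqrt_sum_squares pos by (simp add: a_def b_def r_def)
  have "((2 * b * h$i + 2 * a * h$j) * r - (2 * a * b) * ((a * h$i + b * h$j) / r)) / (r * r) =
      h$i * ((2 * b\<^sup>2 * b) / ((a\<^sup>2 + b\<^sup>2) * r)) + h$j * ((2 * a\<^sup>2 * a) / ((a\<^sup>2 + b\<^sup>2) * r))"
    (is "?L = ?R") for h :: "real^'n"
  proof -
    \<comment> \<open>After the same expansion the mixed terms cancel: 2b(a^2 + b^2) - 2ab * a =
      2b^3, and symmetrically 2a^3 for \<open>h$j\<close>.\<close>
    have "?L = ((2 * b * h$i + 2 * a * h$j) * r\<^sup>2 - (2 * a * b) * (a * h$i + b * h$j)) / (r\<^sup>2 * r)"
      using r(1) by (simp add: field_simps power2_eq_square)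
    also have "\<dots> = ?R"
      unfolding r(2) by (simp add: add_divide_distrib[symmetric]) (simp add: algebra_simps power2_eq_square)
    finally show ?thesis .
  qed
  from has_derivative_divide'[OF num den, folded a_def b_def, folded r_def, unfolded this] assms
  show ?thesis
    by (simp add: a_def b_def r_def)
qed

section \<open>Assembly of the Jacobian matrix and its transpose\<close>

lemma vector_matrix_mult_4_nth:
  fixes A :: "'a::comm_semiring_1^'n^4"
  shows "(h v* A) $ j = h$1 * A$1$j + h$2 * A$2$j + h$3 * A$3$j + h$4 * A$4$j"
  by (simp add: vector_matrix_mult_def sum_4 mult.commute)

text \<open>Division by zero yields \<open>0\<close>, so the case distinctions in \<open>g_map\<close> are redundant.\<close>

lemma g_map_eq:
  "g_map x = vector
    [((x$1)\<^sup>2 - (x$2)\<^sup>2) / sqrt ((x$1)\<^sup>2 + (x$2)\<^sup>2),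
     (2 * x$1 * x$2) / sqrt ((x$1)\<^sup>2 + (x$2)\<^sup>2),
     ((x$3)\<^sup>2 - (x$4)\<^sup>2) / sqrt ((x$3)\<^sup>2 + (x$4)\<^sup>2),
     (2 * x$3 * x$4) / sqrt ((x$3)\<^sup>2 + (x$4)\<^sup>2)]"
  by (simp add: g_map_def vec_eq_iff forall_4)

theorem theorem5p10:
  fixes z :: "real^4"
  assumes "z \<noteq> 0"
    and "((z$1)^2 + (z$2)^2) * ((z$3)^2 + (z$4)^2) \<noteq> 0"
  shows "(g_map has_derivative (\<lambda>u. u v* (vector
      [vector [(((z$1)^2 + 3 * (z$2)^2) * z$1) / (((z$1)^2 + (z$2)^2) * sqrt ((z$1)^2 + (z$2)^2)),
               (2 * (z$2)^2 * z$2) / (((z$1)^2 + (z$2)^2) * sqrt ((z$1)^2 + (z$2)^2)),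
               0,
               0],
       vector [(- (3 * (z$1)^2 + (z$2)^2) * z$2) / (((z$1)^2 + (z$2)^2) * sqrt ((z$1)^2 + (z$2)^2)),
               (2 * (z$1)^2 * z$1) / (((z$1)^2 + (z$2)^2) * sqrt ((z$1)^2 + (z$2)^2)),
               0,
               0],
       vector [0,
               0,
               (((z$3)^2 + 3 * (z$4)^2) * z$3) / (((z$3)^2 + (z$4)^2) * sqrt ((z$3)^2 + (z$4)^2)),
               (2 * (z$4)^2 * z$4) / (((z$3)^2 + (z$4)^2) * sqrt ((z$3)^2 + (z$4)^2))],
       vector [0,
               0,
               (- (3 * (z$3)^2 + (z$4)^2) * z$4) / (((z$3)^2 + (z$4)^2) * sqrt ((z$3)^2 + (z$4)^2)),
               (2 * (z$3)^2 * z$3) / (((z$3)^2 + (z$4)^2) * sqrt ((z$3)^2 + (z$4)^2))]] :: real^4^4))) (at z) \<and>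
    mordukhovich_differentiable g_map z \<and>
    (\<forall>y. mordukhovich_derivative g_map z y = {y v* (vector
      [vector [(((z$1)^2 + 3 * (z$2)^2) * z$1) / (((z$1)^2 + (z$2)^2) * sqrt ((z$1)^2 + (z$2)^2)),
               (- (3 * (z$1)^2 + (z$2)^2) * z$2) / (((z$1)^2 + (z$2)^2) * sqrt ((z$1)^2 + (z$2)^2)),
               0,
               0],
       vector [(2 * (z$2)^2 * z$2) / (((z$1)^2 + (z$2)^2) * sqrt ((z$1)^2 + (z$2)^2)),
               (2 * (z$1)^2 * z$1) / (((z$1)^2 + (z$2)^2) * sqrt ((z$1)^2 + (z$2)^2)),
               0,
               0],
       vector [0,
               0,
               (((z$3)^2 + 3 * (z$4)^2) * z$3) / (((z$3)^2 + (z$4)^2) * sqrt ((z$3)^2 + (z$4)^2)),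
               (- (3 * (z$3)^2 + (z$4)^2) * z$4) / (((z$3)^2 + (z$4)^2) * sqrt ((z$3)^2 + (z$4)^2))],
       vector [0,
               0,
               (2 * (z$4)^2 * z$4) / (((z$3)^2 + (z$4)^2) * sqrt ((z$3)^2 + (z$4)^2)),
               (2 * (z$3)^2 * z$3) / (((z$3)^2 + (z$4)^2) * sqrt ((z$3)^2 + (z$4)^2))]] :: real^4^4)}) \<and>
    (\<forall>x y. mordukhovich_derivative g_map z y = {x} \<longrightarrow>
      x$1 = y$1 * ((((z$1)^2 + 3 * (z$2)^2) * z$1) / (((z$1)^2 + (z$2)^2) * sqrt ((z$1)^2 + (z$2)^2)))
          + y$2 * ((2 * (z$2)^2 * z$2) / (((z$1)^2 + (z$2)^2) * sqrt ((z$1)^2 + (z$2)^2))) \<and>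
      x$2 = y$1 * (((- 3 * (z$1)^2 - (z$2)^2) * z$2) / (((z$1)^2 + (z$2)^2) * sqrt ((z$1)^2 + (z$2)^2)))
          + y$2 * ((2 * (z$1)^2 * z$1) / (((z$1)^2 + (z$2)^2) * sqrt ((z$1)^2 + (z$2)^2))) \<and>
      x$3 = y$3 * ((((z$3)^2 + 3 * (z$4)^2) * z$3) / (((z$3)^2 + (z$4)^2) * sqrt ((z$3)^2 + (z$4)^2)))
          + y$4 * ((2 * (z$4)^2 * z$4) / (((z$3)^2 + (z$4)^2) * sqrt ((z$3)^2 + (z$4)^2))) \<and>
      x$4 = y$3 * ((- (3 * (z$3)^2 + (z$4)^2) * z$4) / (((z$3)^2 + (z$4)^2) * sqrt ((z$3)^2 + (z$4)^2)))
          + y$4 * ((2 * (z$3)^2 * z$3) / (((z$3)^2 + (z$4)^2) * sqrt ((z$3)^2 + (z$4)^2))))"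
    (is "(_ has_derivative (\<lambda>u. u v* ?A)) _ \<and> _ \<and> (\<forall>y. _ y = {y v* ?B}) \<and> _")
proof -
  have nz: "(z$1)\<^sup>2 + (z$2)\<^sup>2 \<noteq> 0" "(z$3)\<^sup>2 + (z$4)\<^sup>2 \<noteq> 0"
    using assms(2) by auto
  have deriv: "(g_map has_derivative (\<lambda>u. u v* ?A)) (at z)"
  \<comment> \<open>Component \<open>i\<close> of \<open>h v* ?A\<close> reads column
    \<open>i\<close> of \<open>?A\<close>. The zero entries remove the other pair of coordinates,
    which leaves one of the two derivative formulas above for the pair (1, 2) or (3, 4).\<close>
  proof (rule has_derivative_vec_nthI)
    fix i :: 4
    consider "i = 1" | "i = 2" | "i = 3" | "i = 4"
      using exhaust_4[of i] by blast
    then show "((\<lambda>x. g_map x $ i) has_derivative (\<lambda>h. (h v* ?A) $ i)) (at z)"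
      by cases (simp_all only: g_map_eq vector_4 vector_matrix_mult_4_nth mult_zero_right
          add_0_left add_0_right has_derivative_square_diff_over_norm[OF nz(1)]
          has_derivative_two_mult_over_norm[OF nz(1)] has_derivative_square_diff_over_norm[OF nz(2)]
          has_derivative_two_mult_over_norm[OF nz(2)])
  qed
  have "transpose ?A = ?B"
    by (simp add: transpose_def vec_eq_iff forall_4)
  from mordukhovich_derivative_matrix[OF deriv, unfolded this]
  have coderiv: "mordukhovich_derivative g_map z y = {y v* ?B}" for y .
  have coord: "x = y v* ?B" if "mordukhovich_derivative g_map z y = {x}" for x y
    using that unfolding coderiv by blast
  show ?thesis
  proof (intro conjI allI)
    show "mordukhovich_differentiable g_map z"
      by (simp add: mordukhovich_differentiable_def coderiv)
  \<comment> \<open>The coordinate formulas are the columns of \<open>?B\<close> written out; the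
    one for \<open>x$2\<close> differs from the matrix entry only by distributing the minus
    sign.\<close>
  qed ((rule deriv coderiv impI)+, drule coord, simp add: vector_matrix_mult_4_nth)
qed

end
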